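(* For every integer $\chi\ge 4$, there exists a graph $G$ with clique number and chromatic number $\omega(G)=\chi(G)=\chi$ and with maximum degree $$\Delta(G)=\chi+\max\left\{1,\ \left\lceil\frac{\chi}{\lceil\sqrt{\chi}\,\rceil}\right\rceil-2\right\}$$ for which $\operatorname{vs}_\chi(G)<\operatorname{ivs}_\chi(G)$.
   Context: Graphs are finite and simple; $\chi(G)$, $\omega(G)$ and $\Delta(G)$ denote the chromatic number, clique number and maximum degree of $G$. The symbol $\chi$ on its own denotes an integer; the subscript $\chi$ in $\operatorname{vs}_\chi,\operatorname{ivs}_\chi$ is only part of the notation. The chromatic vertex stability number $\operatorname{vs}_\chi(G)$ is the minimum size of a set $S\subseteq V(G)$ such that $\chi(G\setminus S)<\chi(G)$. The independent chromatic vertex stability number $\operatorname{ivs}_\chi(G)$ is the minimum size of an independent set $S\subseteq V(G)$ such that $\chi(G\setminus S)<\chi(G)$. *)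

theory Defs
  imports Complex_Main "Graph_Theory.Graph_Theory"
begin

text \<open>
  Finite simple graphs are the \<^const>\<open>graph\<close>s of the library: finite symmetric digraphs without
  loops and parallel arcs. An undirected edge is a pair of opposite arcs, hence the degree of a
  vertex is its out-degree.
\<close>

definition proper_coloring :: "('a, 'b) pre_digraph \<Rightarrow> nat \<Rightarrow> ('a \<Rightarrow> nat) \<Rightarrow> bool" where
  "proper_coloring G k c \<longleftrightarrow>
     (\<forall>v \<in> verts G. c v < k) \<and> (\<forall>u v. u \<rightarrow>\<^bsub>G\<^esub> v \<longrightarrow> c u \<noteq> c v)"

definition chromatic_number :: "('a, 'b) pre_digraph \<Rightarrow> nat" where
  "chromatic_number G = (LEAST k. \<exists>c. proper_coloring G k c)"

definition clique_number :: "('a, 'b) pre_digraph \<Rightarrow> nat" where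
  "clique_number G = Max {n. \<exists>W \<subseteq> verts G. K\<^bsub>n\<^esub> (G \<restriction> W)}"

text \<open>The value is meaningful only if the vertex set is finite and nonempty.\<close>

definition max_degree :: "('a, 'b) pre_digraph \<Rightarrow> nat" where
  "max_degree G = Max (out_degree G ` verts G)"

definition independent_set :: "('a, 'b) pre_digraph \<Rightarrow> 'a set \<Rightarrow> bool" where
  "independent_set G S \<longleftrightarrow> S \<subseteq> verts G \<and> (\<forall>u \<in> S. \<forall>v \<in> S. \<not> u \<rightarrow>\<^bsub>G\<^esub> v)"

definition delete_verts :: "('a, 'b) pre_digraph \<Rightarrow> 'a set \<Rightarrow> ('a, 'b) pre_digraph" where
  "delete_verts G S = G \<restriction> (verts G - S)"

text \<open>
  For a nonempty finite graph both minima below range over nonempty sets; see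
  \<open>ex_independent_set_reducing\<close>.
\<close>

definition vs_chi :: "('a, 'b) pre_digraph \<Rightarrow> nat" where
  "vs_chi G = (LEAST n. \<exists>S \<subseteq> verts G. card S = n \<and>
     chromatic_number (delete_verts G S) < chromatic_number G)"

definition ivs_chi :: "('a, 'b) pre_digraph \<Rightarrow> nat" where
  "ivs_chi G = (LEAST n. \<exists>S. independent_set G S \<and> card S = n \<and>
     chromatic_number (delete_verts G S) < chromatic_number G)"

lemma (in graph) ex_proper_coloring: "\<exists>k c. proper_coloring G k c"
proof -
  obtain c :: "'a \<Rightarrow> nat" and k where c: "c ` verts G = {i. i < k}" "inj_on c (verts G)"
    using finite_imp_inj_to_nat_seg[OF finite_verts] by blast
  have "c u \<noteq> c v" if "u \<rightarrow>\<^bsub>G\<^esub> v" for u v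
    using that c(2) adj_not_same by (metis adj_in_verts inj_on_eq_iff)
  then show ?thesis
    unfolding proper_coloring_def using c(1) by blast
qed

lemma (in graph) ex_independent_set_reducing:
  assumes "verts G \<noteq> {}"
  shows "\<exists>S. independent_set G S \<and>
    chromatic_number (delete_verts G S) < chromatic_number G"
proof -
  let ?k = "chromatic_number G"
  obtain c where c: "proper_coloring G ?k c"
    unfolding chromatic_number_def using LeastI_ex[OF ex_proper_coloring] by blast
  then have k: "?k > 0"
    using assms unfolding proper_coloring_def by (metis all_not_in_conv gr_zeroI not_less_zero)
  define S where "S = {v \<in> verts G. c v = ?k - 1}"
  have "independent_set G S"
    using c unfolding independent_set_def S_def proper_coloring_def
    by (metis (mono_tags, lifting) mem_Collect_eq subsetI)
  moreover have "proper_coloring (delete_verts G S) (?k - 1) c"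
    unfolding proper_coloring_def
  proof (intro conjI ballI allI impI)
    fix v assume "v \<in> verts (delete_verts G S)"
    then have "v \<in> verts G" "c v \<noteq> ?k - 1" by (auto simp: delete_verts_def S_def)
    moreover from this have "c v < ?k" using c by (auto simp: proper_coloring_def)
    ultimately show "c v < ?k - 1" by linarith
  next
    fix u v assume "u \<rightarrow>\<^bsub>delete_verts G S\<^esub> v"
    then have "u \<rightarrow>\<^bsub>G\<^esub> v"
      unfolding delete_verts_def by (rule dominates_induce_subgraphD)
    then show "c u \<noteq> c v" using c by (simp add: proper_coloring_def)
  qed
  then have "chromatic_number (delete_verts G S) \<le> ?k - 1"
    unfolding chromatic_number_def[of "delete_verts G S"] by (intro Least_le) blast
  ultimately show ?thesis using k by (intro exI[of _ S]) linarith
qed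

end

theory Submission
  imports Defs "HOL-Library.Countable"
begin

text \<open>
  Put \<open>k = \<chi>\<close>. The graph is a core clique on \<open>k\<close> vertices together with two disjoint
  copies of a gadget that, when only \<open>k - 1\<close> colours are available, behaves like one further
  vertex adjacent to the whole core. A gadget is a clique of \<open>k - 2\<close> hub vertices joined
  completely to an independent set of \<open>d\<close> ports; every core vertex is adjacent to exactly one
  port of each gadget. With \<open>k - 1\<close> colours the hubs leave only one colour for all ports, and
  this colour is then forbidden on the core. With \<open>k\<close> colours two colours remain for the ports,
  and the gadget imposes no obstacle: the whole graph is \<open>k\<close>-chromatic.

  Deleting two core vertices leaves a core on \<open>k - 2\<close> vertices, which can avoid the common colour
  of the ports, so the vertex stability number is at most 2
  (\<open>colorable_minus_two_core\<close>). An independent set of size at most 2, however, contains at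
  most one core vertex, and it must contain one, since the core is a clique of size \<open>k\<close>. Its
  other vertex damages at most one gadget. The remaining \<open>k - 1\<close> core vertices use all \<open>k - 1\<close>
  colours, among them the colour that the other gadget forbids
  (\<open>not_colorable_delete_independent_pair\<close>).

  The gadget spreads the \<open>k\<close> edges that lead to the core over \<open>d\<close> ports in order to keep the
  degrees low. A hub has degree \<open>(k - 3) + d\<close>, a core vertex \<open>(k - 1) + 2\<close>, and a
  port that serves at most \<open>d - 1\<close> core vertices has degree at most \<open>(k - 2) + (d - 1)\<close>. So for
  \<open>d \<ge> 4\<close> the maximum degree is \<open>k + d - 3\<close>, as soon as \<open>k \<le> d (d - 1)\<close>. This
  is the origin of the square root: with \<open>m = \<lceil>k / \<lceil>\<surd>k\<rceil>\<rceil>\<close> one has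
  \<open>k \<le> m (m + 1)\<close>, so that \<open>d = max 3 m + 1\<close> is admissible, and it gives exactly the
  required maximum degree.
\<close>

section \<open>Graphs from adjacency relations\<close>

definition colorable :: "'a set \<Rightarrow> ('a \<Rightarrow> 'a \<Rightarrow> bool) \<Rightarrow> nat \<Rightarrow> bool" where
  "colorable V E k \<longleftrightarrow>
     (\<exists>c :: 'a \<Rightarrow> nat. (\<forall>a \<in> V. c a < k) \<and> (\<forall>a \<in> V. \<forall>b \<in> V. E a b \<longrightarrow> c a \<noteq> c b))"

text \<open>
  Vertices are encoded as natural numbers by \<^const>\<open>to_nat\<close>, so that a construction can be
  described on a datatype of structured vertices.
\<close>

definition graph_of :: "'a::countable set \<Rightarrow> ('a \<Rightarrow> 'a \<Rightarrow> bool) \<Rightarrow> (nat, nat \<times> nat) pre_digraph" where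
  "graph_of V E = \<lparr>verts = to_nat ` V,
     arcs = (\<lambda>(a, b). (to_nat a, to_nat b)) ` {(a, b). a \<in> V \<and> b \<in> V \<and> E a b},
     tail = fst, head = snd\<rparr>"

lemma verts_graph_of [simp]: "verts (graph_of V E) = to_nat ` V"
  by (simp add: graph_of_def)

lemma dominates_graph_of_iff:
  "x \<rightarrow>\<^bsub>graph_of V E\<^esub> y \<longleftrightarrow> (\<exists>a \<in> V. \<exists>b \<in> V. E a b \<and> x = to_nat a \<and> y = to_nat b)"
  by (force simp: graph_of_def arcs_ends_conv)

lemma dominates_graph_of_to_nat [simp]:
  "to_nat a \<rightarrow>\<^bsub>graph_of V E\<^esub> to_nat b \<longleftrightarrow> a \<in> V \<and> b \<in> V \<and> E a b"
  by (auto simp: dominates_graph_of_iff)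

lemma graph_graph_of:
  assumes "finite V" "irreflp E" "symp E"
  shows "graph (graph_of V E)"
proof unfold_locales
  show "finite (arcs (graph_of V E))"
    by (rule finite_subset[of _ "to_nat ` V \<times> to_nat ` V"]) (auto simp: graph_of_def assms(1))
  show "symmetric (graph_of V E)"
    unfolding symmetric_def using assms(3) by (auto simp: sym_def dominates_graph_of_iff symp_def)
qed (use assms in \<open>auto simp: graph_of_def arc_to_ends_def irreflp_def\<close>)

lemma induce_graph_of:
  assumes "W \<subseteq> V"
  shows "graph_of V E \<restriction> (to_nat ` W) = graph_of W E"
proof -
  have "{e \<in> arcs (graph_of V E). fst e \<in> to_nat ` W \<and> snd e \<in> to_nat ` W} = arcs (graph_of W E)"
    using assms by (auto simp: graph_of_def)
  then show ?thesis by (simp add: induce_subgraph_def graph_of_def)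
qed

lemma delete_verts_graph_of:
  "delete_verts (graph_of V E) (to_nat ` S) = graph_of (V - S) E"
proof -
  have "to_nat ` V - to_nat ` S = to_nat ` (V - S)"
    by (simp add: image_set_diff)
  then show ?thesis by (simp add: delete_verts_def induce_graph_of)
qed

lemma out_degree_graph_of:
  assumes "a \<in> V"
  shows "out_degree (graph_of V E) (to_nat a) = card {b \<in> V. E a b}"
proof -
  have "out_arcs (graph_of V E) (to_nat a) = (\<lambda>b. (to_nat a, to_nat b)) ` {b \<in> V. E a b}"
    using assms by (auto simp: out_arcs_def graph_of_def)
  then show ?thesis
    by (simp add: out_degree_def card_image inj_on_def)
qed

lemma ex_proper_coloring_graph_of_iff:
  "(\<exists>c. proper_coloring (graph_of V E) k c) \<longleftrightarrow> colorable V E k"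
proof
  assume "\<exists>c. proper_coloring (graph_of V E) k c"
  then obtain c where c: "proper_coloring (graph_of V E) k c" ..
  show "colorable V E k"
    unfolding colorable_def
    by (rule exI[of _ "\<lambda>a. c (to_nat a)"])
      (use c in \<open>auto simp: proper_coloring_def\<close>)
next
  assume "colorable V E k"
  then obtain c where c: "\<forall>a \<in> V. c a < k" "\<forall>a \<in> V. \<forall>b \<in> V. E a b \<longrightarrow> c a \<noteq> c b"
    unfolding colorable_def by blast
  then show "\<exists>c. proper_coloring (graph_of V E) k c"
    by (intro exI[of _ "\<lambda>x. c (from_nat x)"])
      (auto simp: proper_coloring_def dominates_graph_of_iff)
qed

section \<open>Chromatic number and clique number\<close>

lemma proper_coloring_mono: "proper_coloring G k c \<Longrightarrow> k \<le> l \<Longrightarrow> proper_coloring G l c"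
  unfolding proper_coloring_def by fastforce

lemma (in graph) chromatic_number_le_iff:
  "chromatic_number G \<le> k \<longleftrightarrow> (\<exists>c. proper_coloring G k c)"
proof
  assume "chromatic_number G \<le> k"
  moreover have "\<exists>c. proper_coloring G (chromatic_number G) c"
    unfolding chromatic_number_def by (rule LeastI_ex[OF ex_proper_coloring])
  ultimately show "\<exists>c. proper_coloring G k c"
    using proper_coloring_mono by blast
qed (auto simp: chromatic_number_def intro: Least_le)

lemma chromatic_number_graph_of_le_iff:
  assumes "finite V" "irreflp E" "symp E"
  shows "chromatic_number (graph_of V E) \<le> k \<longleftrightarrow> colorable V E k"
  using graph.chromatic_number_le_iff[OF graph_graph_of[OF assms]]
  by (simp add: ex_proper_coloring_graph_of_iff)

lemma colorable_clique_card_le: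
  assumes "colorable V E k" "C \<subseteq> V" "\<And>a b. a \<in> C \<Longrightarrow> b \<in> C \<Longrightarrow> a \<noteq> b \<Longrightarrow> E a b"
  shows "card C \<le> k"
proof -
  from assms(1) obtain c :: "'a \<Rightarrow> nat" where
    c: "\<forall>a \<in> V. c a < k" "\<forall>a \<in> V. \<forall>b \<in> V. E a b \<longrightarrow> c a \<noteq> c b"
    unfolding colorable_def by blast
  have "card C = card (c ` C)"
    using c(2) assms(2,3) by (intro card_image[symmetric] inj_onI) (metis subsetD)
  also have "\<dots> \<le> card {..<k}"
    using c(1) assms(2) by (intro card_mono) auto
  finally show ?thesis by simp
qed

text \<open>
  This and the next lemma reduce the clique number to a clique whose size matches a colouring: such
  a clique is largest possible, because a colouring is injective on every clique.
\<close>

lemma complete_induce_graph_of_iff: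
  assumes "finite V" "irreflp E" "symp E" "W \<subseteq> V"
  shows "K\<^bsub>n\<^esub> (graph_of V E \<restriction> (to_nat ` W)) \<longleftrightarrow>
    card W = n \<and> (\<forall>a \<in> W. \<forall>b \<in> W. a \<noteq> b \<longrightarrow> E a b)"
proof -
  have "arcs_ends (graph_of W E) = {(u, v). (u, v) \<in> to_nat ` W \<times> to_nat ` W \<and> u \<noteq> v} \<longleftrightarrow>
    (\<forall>a \<in> W. \<forall>b \<in> W. a \<noteq> b \<longrightarrow> E a b)" (is "?L \<longleftrightarrow> ?R")
  proof
    assume L: ?L
    show ?R
    proof (intro ballI impI)
      fix a b assume "a \<in> W" "b \<in> W" "a \<noteq> b"
      then have "to_nat a \<rightarrow>\<^bsub>graph_of W E\<^esub> to_nat b" unfolding L by simp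
      then show "E a b" by simp
    qed
  next
    assume ?R
    then show ?L
      using assms(2) by (auto simp: dominates_graph_of_iff irreflp_def)
  qed
  moreover have "graph (graph_of W E)"
    using assms by (intro graph_graph_of) (auto intro: finite_subset)
  ultimately show ?thesis
    using assms(4) by (simp add: induce_graph_of complete_digraph_def card_image)
qed

lemma clique_number_graph_of_eqI:
  assumes "finite V" "irreflp E" "symp E"
    and "colorable V E k" and "C \<subseteq> V" "card C = k" "\<And>a b. a \<in> C \<Longrightarrow> b \<in> C \<Longrightarrow> a \<noteq> b \<Longrightarrow> E a b"
  shows "clique_number (graph_of V E) = k"
proof -
  let ?N = "{n. \<exists>W \<subseteq> verts (graph_of V E). K\<^bsub>n\<^esub> (graph_of V E \<restriction> W)}"
  have ex_subset: "(\<exists>X \<subseteq> to_nat ` V. P X) \<longleftrightarrow> (\<exists>W \<subseteq> V. P (to_nat ` W))" for P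
    by (metis subset_image_iff)
  have N: "?N = {n. \<exists>W \<subseteq> V. card W = n \<and> (\<forall>a \<in> W. \<forall>b \<in> W. a \<noteq> b \<longrightarrow> E a b)}"
    by (simp add: ex_subset complete_induce_graph_of_iff[OF assms(1-3)] cong: conj_cong)
  have "?N \<subseteq> {..k}"
    unfolding N using colorable_clique_card_le[OF assms(4)] by auto
  moreover from this have "finite ?N" by (rule finite_subset) simp
  moreover have "k \<in> ?N"
    unfolding N using assms(5-7) by blast
  ultimately show ?thesis
    unfolding clique_number_def by (intro Max_eqI) auto
qed

text \<open>
  The set \<open>S\<close> bounds the first minimum from above. The second minimum must be known to be
  attained, since \<open>LEAST\<close> over an empty set of sizes would be unspecified; this is what
  nonemptiness of the graph is for.
\<close>

lemma (in graph) vs_chi_less_ivs_chiI: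
  assumes "verts G \<noteq> {}"
    and "S \<subseteq> verts G" "chromatic_number (delete_verts G S) < chromatic_number G"
    and "\<And>T. independent_set G T \<Longrightarrow>
      chromatic_number (delete_verts G T) < chromatic_number G \<Longrightarrow> card S < card T"
  shows "vs_chi G < ivs_chi G"
proof -
  have "vs_chi G \<le> card S"
    unfolding vs_chi_def using assms(2,3) by (intro Least_le) blast
  moreover obtain T where "independent_set G T" "card T = ivs_chi G"
    "chromatic_number (delete_verts G T) < chromatic_number G"
    using LeastI_ex[of "\<lambda>n. \<exists>S. independent_set G S \<and> card S = n \<and>
      chromatic_number (delete_verts G S) < chromatic_number G"]
      ex_independent_set_reducing[OF assms(1)]
    unfolding ivs_chi_def by blast
  ultimately show ?thesis using assms(4) by fastforce
qed

section \<open>A clique core watched by two gadgets\<close>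

datatype vertex = Core nat | Hub bool nat | Port bool nat

instance vertex :: countable
  by countable_datatype

text \<open>
  Assigning core vertex \<open>i\<close> to port \<open>i mod d\<close> balances the load of the \<open>d\<close> ports. The Boolean
  tells the two gadgets apart.
\<close>

fun adj :: "nat \<Rightarrow> vertex \<Rightarrow> vertex \<Rightarrow> bool" where
  "adj d (Core i) (Core j) \<longleftrightarrow> i \<noteq> j"
| "adj d (Core i) (Port b p) \<longleftrightarrow> p = i mod d"
| "adj d (Port b p) (Core i) \<longleftrightarrow> p = i mod d"
| "adj d (Hub b i) (Hub b' j) \<longleftrightarrow> b = b' \<and> i \<noteq> j"
| "adj d (Hub b i) (Port b' p) \<longleftrightarrow> b = b'"
| "adj d (Port b p) (Hub b' i) \<longleftrightarrow> b = b'"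
| "adj d _ _ \<longleftrightarrow> False"

definition vertices :: "nat \<Rightarrow> nat \<Rightarrow> vertex set" where
  "vertices k d = Core ` {..<k} \<union> (\<Union>b. Hub b ` {..<k - 2} \<union> Port b ` {..<d})"

lemma irreflp_adj: "irreflp (adj d)"
proof (rule irreflpI)
  show "\<not> adj d a a" for a by (cases a) auto
qed

lemma symp_adj: "symp (adj d)"
proof (rule sympI)
  show "adj d a b \<Longrightarrow> adj d b a" for a b by (cases a; cases b) auto
qed

lemma finite_vertices: "finite (vertices k d)"
  by (auto simp: vertices_def)

lemma vertices_iff [simp]:
  "Core i \<in> vertices k d \<longleftrightarrow> i < k"
  "Hub b i \<in> vertices k d \<longleftrightarrow> i < k - 2"
  "Port b i \<in> vertices k d \<longleftrightarrow> i < d"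
  by (auto simp: vertices_def)

lemma card_core: "card (Core ` A) = card A" by (simp add: card_image inj_on_def)
lemma card_hub: "card (Hub b ` A) = card A" by (simp add: card_image inj_on_def)
lemma card_port: "card (Port b ` A) = card A" by (simp add: card_image inj_on_def)

lemma colorable_construction:
  assumes "k \<ge> 4" "d \<ge> 2"
  shows "colorable (vertices k d) (adj d) k"
proof -
  \<comment> \<open>The core clique uses every colour; in each gadget the hubs leave the colours 0 and 1. All ports
    take 0, except port 0, which is adjacent to the core vertex of colour 0. This port is not
    adjacent to the core vertex of colour 1, which is assigned to port 1 because \<open>d \<ge> 2\<close>.\<close>
  define c where "c v = (case v of Core i \<Rightarrow> i | Hub _ i \<Rightarrow> i + 2
    | Port _ p \<Rightarrow> if p = 0 then 1 else 0)" for v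
  show ?thesis
    unfolding colorable_def
  proof (intro exI[of _ c] conjI ballI impI)
    fix a assume "a \<in> vertices k d"
    then show "c a < k" using assms by (cases a) (auto simp: c_def)
  next
    fix a b assume "a \<in> vertices k d" "b \<in> vertices k d" "adj d a b"
    then show "c a \<noteq> c b"
      using assms by (cases a; cases b) (auto simp: c_def intro!: gr0I)
  qed
qed

lemma colorable_minus_two_core:
  assumes "k \<ge> 4"
  shows "colorable (vertices k d - Core ` {0, 1}) (adj d) (k - 1)"
proof -
  \<comment> \<open>Colour 0 is reserved for the ports; the core vertices from 2 on and the hubs need only the
    \<open>k - 2\<close> others.\<close>
  define c where "c v = (case v of Core i \<Rightarrow> i - 1 | Hub _ i \<Rightarrow> i + 1 | Port _ p \<Rightarrow> 0)" for v
  show ?thesis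
    unfolding colorable_def
  proof (intro exI[of _ c] conjI ballI impI)
    fix a assume "a \<in> vertices k d - Core ` {0, 1}"
    then show "c a < k - 1" using assms by (cases a) (auto simp: c_def)
  next
    fix a b assume "a \<in> vertices k d - Core ` {0, 1}" "b \<in> vertices k d - Core ` {0, 1}" "adj d a b"
    then show "c a \<noteq> c b" using assms by (cases a; cases b) (auto simp: c_def)
  qed
qed

text \<open>
  The hubs use up all but one of the \<open>k - 1\<close> colours, so the ports are monochromatic. The
  core vertices other than \<open>i\<close> form a clique of size \<open>k - 1\<close>, hence one of them has the colour
  of the ports; but it is adjacent to a port.
\<close>

lemma not_colorable_intact_gadget:
  assumes "d > 0" and k: "k \<ge> 2" and i: "i < k"
    and V: "Core ` ({..<k} - {i}) \<subseteq> V" "Hub b ` {..<k - 2} \<subseteq> V" "Port b ` {..<d} \<subseteq> V"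
  shows "\<not> colorable V (adj d) (k - 1)"
proof
  assume "colorable V (adj d) (k - 1)"
  then obtain c :: "vertex \<Rightarrow> nat" where
    c: "\<And>v. v \<in> V \<Longrightarrow> c v < k - 1" "\<And>u v. u \<in> V \<Longrightarrow> v \<in> V \<Longrightarrow> adj d u v \<Longrightarrow> c u \<noteq> c v"
    unfolding colorable_def by blast
  let ?C = "Core ` ({..<k} - {i})" and ?H = "Hub b ` {..<k - 2}" and ?P = "Port b ` {..<d}"
  have inj: "inj_on c W" if "W \<subseteq> V" "\<forall>u \<in> W. \<forall>v \<in> W. u \<noteq> v \<longrightarrow> adj d u v" for W
    using that c(2) by (meson inj_onI subsetD)
  have "inj_on c ?C" by (rule inj[OF V(1)]) auto
  moreover have "inj_on c ?H" by (rule inj[OF V(2)]) auto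
  ultimately have cards: "card (c ` ?C) = k - 1" "card (c ` ?H) = k - 2"
    using i by (simp_all add: card_image card_core card_hub)
  have sub: "c ` (?C \<union> ?H \<union> ?P) \<subseteq> {..<k - 1}"
    using c(1) V by blast
  have "c ` ?C = {..<k - 1}"
    using sub cards(1) by (intro card_subset_eq) auto
  have "card ({..<k - 1} - c ` ?H) = 1"
    using sub cards(2) k by (subst card_Diff_subset) auto
  then obtain r where r: "{..<k - 1} - c ` ?H = {r}"
    by (rule card_1_singletonE)
  have P: "c v = r" if "v \<in> ?P" for v
  proof -
    have "c v \<notin> c ` ?H"
      using that c(2) V(2,3) by (force simp: image_subset_iff)
    then show ?thesis using sub that r by blast
  qed
  obtain j where j: "j < k" "j \<noteq> i" "c (Core j) = r"
  proof -
    have "r \<in> c ` ?C" using \<open>c ` ?C = {..<k - 1}\<close> r by blast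
    then show thesis by (auto intro: that)
  qed
  have p: "Port b (j mod d) \<in> ?P"
    using \<open>d > 0\<close> by simp
  have "c (Core j) \<noteq> c (Port b (j mod d))"
    using V p j by (intro c(2)) auto
  then show False using P[OF p] j(3) by simp
qed

text \<open>
  Independence excludes the deletion of two core vertices, the only way to gain from two
  deletions: a single vertex outside the core cannot damage both gadgets.
\<close>

lemma not_colorable_delete_independent_pair:
  assumes "d > 0" "k \<ge> 2"
    and T: "finite T" "\<And>a b. a \<in> T \<Longrightarrow> b \<in> T \<Longrightarrow> \<not> adj d a b" "card T \<le> 2"
  shows "\<not> colorable (vertices k d - T) (adj d) (k - 1)"
proof
  assume col: "colorable (vertices k d - T) (adj d) (k - 1)"
  have "\<not> Core ` {..<k} \<subseteq> vertices k d - T"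
  proof
    assume "Core ` {..<k} \<subseteq> vertices k d - T"
    then have "card (Core ` {..<k}) \<le> k - 1"
      by (rule colorable_clique_card_le[OF col]) auto
    then have "k \<le> k - 1" by (simp add: card_core)
    then show False using \<open>k \<ge> 2\<close> by simp
  qed
  then obtain i where i: "i < k" "Core i \<in> T" by auto
  have core: "Core ` ({..<k} - {i}) \<subseteq> vertices k d - T"
    using T(2)[OF i(2)] by fastforce
  have "card (T - {Core i}) \<le> 1"
    using T i(2) by simp
  then have "T - {Core i} = {} \<or> card (T - {Core i}) = 1"
    unfolding card_0_eq[OF finite_Diff[OF T(1)], symmetric] by linarith
  then obtain v where v: "T \<subseteq> {Core i, v}"
    by (metis Diff_eq_empty_iff Diff_subset_conv card_1_singletonE insert_is_Un order_refl
        subset_insertI2)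
  have "\<exists>b. \<forall>n. v \<noteq> Hub b n \<and> v \<noteq> Port b n"
    by (cases v) (simp_all add: ex_bool_eq)
  then obtain b where "\<And>n. v \<noteq> Hub b n \<and> v \<noteq> Port b n" by blast
  then have "Hub b n \<notin> T" "Port b n \<notin> T" for n
    using v by auto
  then have "Hub b ` {..<k - 2} \<subseteq> vertices k d - T" "Port b ` {..<d} \<subseteq> vertices k d - T"
    by auto
  with not_colorable_intact_gadget[OF assms(1,2) i(1) core] col show False by blast
qed

lemma card_residue_class_le:
  fixes d :: nat
  assumes "k \<le> m * d"
  shows "card {j. j < k \<and> j mod d = i} \<le> m"
proof -
  have "inj_on (\<lambda>j. j div d) {j. j < k \<and> j mod d = i}"
    by (rule inj_onI) (metis (mono_tags, lifting) div_mult_mod_eq mem_Collect_eq)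
  moreover have "(\<lambda>j. j div d) ` {j. j < k \<and> j mod d = i} \<subseteq> {..<m}"
    using assms by (auto simp: less_mult_imp_div_less)
  ultimately show ?thesis
    using card_inj_on_le[of _ _ "{..<m}"] by simp
qed

text \<open>
  The hubs attain the maximum. The bound \<open>k \<le> (d - 1) * d\<close> limits the load of each port to
  \<open>d - 1\<close> core vertices, and \<open>d \<ge> 4\<close> puts the degree \<open>k + 1\<close> of the core vertices below that of
  the hubs.
\<close>

lemma max_degree_construction:
  assumes "k \<ge> 4" "d \<ge> 4" "k \<le> (d - 1) * d"
  shows "max_degree (graph_of (vertices k d) (adj d)) = k + d - 3"
proof -
  let ?V = "vertices k d"
  let ?nb = "\<lambda>a. {b \<in> ?V. adj d a b}"
  have core: "card (?nb (Core i)) \<le> k + d - 3" if "i < k" for i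
  proof -
    have "?nb (Core i) \<subseteq> Core ` ({..<k} - {i}) \<union> {Port True (i mod d), Port False (i mod d)}"
    proof
      fix v assume "v \<in> ?nb (Core i)"
      then show "v \<in> Core ` ({..<k} - {i}) \<union> {Port True (i mod d), Port False (i mod d)}"
        by (cases v) auto
    qed
    then have "card (?nb (Core i)) \<le> card (Core ` ({..<k} - {i}) \<union> {Port True (i mod d), Port False (i mod d)})"
      by (intro card_mono) auto
    also have "\<dots> \<le> (k - 1) + 2"
      using that by (intro order.trans[OF card_Un_le] add_mono) (auto simp: card_core card_insert_if)
    finally show ?thesis using assms by linarith
  qed
  have hub: "card (?nb (Hub b i)) = k + d - 3" if "i < k - 2" for b i
  proof -
    have "?nb (Hub b i) = Hub b ` ({..<k - 2} - {i}) \<union> Port b ` {..<d}"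
    proof (intro set_eqI)
      fix v show "v \<in> ?nb (Hub b i) \<longleftrightarrow> v \<in> Hub b ` ({..<k - 2} - {i}) \<union> Port b ` {..<d}"
        by (cases v) auto
    qed
    moreover have "card (Hub b ` ({..<k - 2} - {i}) \<union> Port b ` {..<d}) = (k - 3) + d"
      using that by (subst card_Un_disjoint) (auto simp: card_hub card_port)
    ultimately show ?thesis using assms by simp
  qed
  have port: "card (?nb (Port b p)) \<le> k + d - 3" if "p < d" for b p
  proof -
    have "?nb (Port b p) \<subseteq> Hub b ` {..<k - 2} \<union> Core ` {j. j < k \<and> j mod d = p}"
    proof
      fix v assume "v \<in> ?nb (Port b p)"
      then show "v \<in> Hub b ` {..<k - 2} \<union> Core ` {j. j < k \<and> j mod d = p}"
        by (cases v) auto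
    qed
    then have "card (?nb (Port b p)) \<le> card (Hub b ` {..<k - 2} \<union> Core ` {j. j < k \<and> j mod d = p})"
      by (intro card_mono) auto
    also have "\<dots> \<le> (k - 2) + (d - 1)"
      using card_residue_class_le[OF assms(3)]
      by (intro order.trans[OF card_Un_le] add_mono) (auto simp: card_core card_hub)
    finally show ?thesis using assms by linarith
  qed
  have upper: "card (?nb a) \<le> k + d - 3" if "a \<in> ?V" for a
    using that core hub port by (cases a) auto
  have "Hub True 0 \<in> ?V"
    using assms by simp
  moreover have "k + d - 3 = card (?nb (Hub True 0))"
    using hub assms by simp
  ultimately have "k + d - 3 \<in> (\<lambda>a. card (?nb a)) ` ?V"
    by (rule rev_image_eqI)
  with upper have "Max ((\<lambda>a. card (?nb a)) ` ?V) = k + d - 3"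
    by (intro Max_eqI) (use finite_vertices in blast)+
  moreover have "out_degree (graph_of ?V (adj d)) ` to_nat ` ?V = (\<lambda>a. card (?nb a)) ` ?V"
    unfolding image_image by (intro image_cong refl out_degree_graph_of)
  ultimately show ?thesis
    by (simp add: max_degree_def)
qed

theorem ex_graph_vs_chi_less_ivs_chi:
  assumes k: "k \<ge> 4" and d: "d \<ge> 4" "k \<le> (d - 1) * d"
  shows "\<exists>G :: (nat, nat \<times> nat) pre_digraph. graph G \<and> clique_number G = k \<and>
    chromatic_number G = k \<and> max_degree G = k + d - 3 \<and> vs_chi G < ivs_chi G"
proof (intro exI conjI)
  let ?V = "vertices k d" and ?E = "adj d"
  let ?G = "graph_of ?V ?E"
  note chi_iff = chromatic_number_graph_of_le_iff[OF _ irreflp_adj symp_adj]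
  show G: "graph ?G"
    by (rule graph_graph_of[OF finite_vertices irreflp_adj symp_adj])
  have col: "colorable ?V ?E k"
    using k d by (intro colorable_construction) auto
  show "clique_number ?G = k"
    by (rule clique_number_graph_of_eqI[OF finite_vertices irreflp_adj symp_adj col,
          of "Core ` {..<k}"]) (auto simp: card_core)
  have "\<not> colorable ?V ?E (k - 1)"
    using not_colorable_delete_independent_pair[of d k "{}"] k d by simp
  with col have "chromatic_number ?G \<le> k" "\<not> chromatic_number ?G \<le> k - 1"
    by (simp_all add: chi_iff finite_vertices)
  then show chi: "chromatic_number ?G = k" by linarith
  show "max_degree ?G = k + d - 3"
    by (rule max_degree_construction[OF assms])
  have less_iff: "chromatic_number (delete_verts ?G (to_nat ` S)) < chromatic_number ?G \<longleftrightarrow>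
      colorable (?V - S) ?E (k - 1)" for S
    using chi_iff[of "?V - S" d "k - 1"] k
    by (simp add: delete_verts_graph_of finite_vertices chi) linarith
  show "vs_chi ?G < ivs_chi ?G"
  proof (rule graph.vs_chi_less_ivs_chiI[OF G, of "to_nat ` Core ` {0, 1}"])
    have "Core ` {0, 1} \<subseteq> ?V" using k by simp
    then show "to_nat ` Core ` {0, 1} \<subseteq> verts ?G" "verts ?G \<noteq> {}"
      by (simp_all only: verts_graph_of image_mono) blast
    show "chromatic_number (delete_verts ?G (to_nat ` Core ` {0, 1})) < chromatic_number ?G"
      unfolding less_iff using colorable_minus_two_core[OF k] .
  next
    fix T' assume ind: "independent_set ?G T'"
      and red: "chromatic_number (delete_verts ?G T') < chromatic_number ?G"
    from ind obtain T where T: "T' = to_nat ` T" "T \<subseteq> ?V"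
      by (auto simp: independent_set_def subset_image_iff)
    have "finite T" using T(2) finite_vertices by (rule finite_subset)
    moreover have "\<not> ?E a b" if "a \<in> T" "b \<in> T" for a b
    proof -
      have "\<not> to_nat a \<rightarrow>\<^bsub>?G\<^esub> to_nat b"
        using ind that unfolding T(1) independent_set_def by blast
      then show ?thesis using that T(2) by auto
    qed
    moreover have "colorable (?V - T) ?E (k - 1)"
      using red unfolding T(1) less_iff .
    ultimately have "card T > 2"
      using not_colorable_delete_independent_pair[of d k T] k d by force
    then show "card (to_nat ` Core ` {0, 1}) < card T'"
      unfolding T(1) by (simp add: card_image)
  qed
qed

text \<open>
  With \<open>s = \<lceil>\<surd>x\<rceil>\<close> and \<open>m = \<lceil>x / s\<rceil>\<close>, the definition of \<open>m\<close> gives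
  \<open>x \<le> m s\<close>. It remains to see that \<open>s \<le> m + 1\<close>, which holds as
  \<open>x > (s - 1)\<^sup>2 > s (s - 2)\<close>.
\<close>

lemma ceiling_div_ceiling_sqrt_bound:
  fixes x :: real
  assumes "x > 0"
  shows "x \<le> of_int (\<lceil>x / of_int \<lceil>sqrt x\<rceil>\<rceil> * (\<lceil>x / of_int \<lceil>sqrt x\<rceil>\<rceil> + 1))"
proof -
  define s where "s = \<lceil>sqrt x\<rceil>"
  define m where "m = \<lceil>x / of_int s\<rceil>"
  have s: "sqrt x \<le> of_int s" "of_int s - 1 < sqrt x" "s \<ge> 1"
    using assms unfolding s_def by (auto intro: le_of_int_ceiling) linarith
  have m: "x / of_int s \<le> of_int m" unfolding m_def by (rule le_of_int_ceiling)
  have "(of_int s - 1)\<^sup>2 < (sqrt x)\<^sup>2"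
    using s by (intro power_strict_mono) auto
  then have "of_int s * (of_int s - 2) < x"
    using assms by (simp add: power2_eq_square algebra_simps)
  then have "of_int s - 2 < x / of_int s"
    using s(3) by (simp add: field_simps)
  with m have "s \<le> m + 1" by linarith
  have "x \<le> of_int m * of_int s"
    using m s(3) by (simp add: field_simps)
  also have "\<dots> \<le> of_int m * of_int (m + 1)"
    using \<open>s \<le> m + 1\<close> s(3) by (intro mult_left_mono) linarith+
  finally show ?thesis unfolding m_def s_def by simp
qed

theorem proposition9:
  fixes \<chi> :: int
  assumes "\<chi> \<ge> 4"
  shows "\<exists>G :: (nat, nat \<times> nat) pre_digraph. graph G \<and>
    int (clique_number G) = \<chi> \<and> int (chromatic_number G) = \<chi> \<and>
    int (max_degree G) =
      \<chi> + max 1 (\<lceil>real_of_int \<chi> / real_of_int \<lceil>sqrt (real_of_int \<chi>)\<rceil>\<rceil> - 2) \<and>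
    vs_chi G < ivs_chi G"
proof -
  define m where "m = \<lceil>real_of_int \<chi> / real_of_int \<lceil>sqrt (real_of_int \<chi>)\<rceil>\<rceil>"
  define M where "M = max 3 m"
  have "real_of_int \<chi> \<le> of_int (m * (m + 1))"
    unfolding m_def using assms by (intro ceiling_div_ceiling_sqrt_bound) simp
  then have "\<chi> \<le> m * (m + 1)" by (simp only: of_int_le_iff)
  moreover have "m \<ge> 0"
  proof -
    have "0 \<le> sqrt (real_of_int \<chi>)" using assms by simp
    then have "0 \<le> \<lceil>sqrt (real_of_int \<chi>)\<rceil>" by linarith
    then have "0 \<le> real_of_int \<chi> / real_of_int \<lceil>sqrt (real_of_int \<chi>)\<rceil>"
      using assms by (intro divide_nonneg_nonneg) simp_all
    then show ?thesis unfolding m_def by linarith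
  qed
  ultimately have "\<chi> \<le> M * (M + 1)"
    unfolding M_def by (smt (verit) mult_mono)
  moreover have "M \<ge> 3" unfolding M_def by simp
  moreover from this have "(nat (M + 1) - 1) * nat (M + 1) = nat (M * (M + 1))"
    by (simp add: nat_add_distrib nat_mult_distrib)
  ultimately have "nat \<chi> \<le> (nat (M + 1) - 1) * nat (M + 1)"
    by simp
  then obtain G :: "(nat, nat \<times> nat) pre_digraph" where "graph G" "clique_number G = nat \<chi>"
    "chromatic_number G = nat \<chi>" "max_degree G = nat \<chi> + nat (M + 1) - 3" "vs_chi G < ivs_chi G"
  proof -
    have "nat \<chi> \<ge> 4" "nat (M + 1) \<ge> 4" using assms \<open>M \<ge> 3\<close> by linarith+
    from ex_graph_vs_chi_less_ivs_chi[OF this \<open>nat \<chi> \<le> (nat (M + 1) - 1) * nat (M + 1)\<close>]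
    show thesis using that by blast
  qed
  moreover have "int (nat \<chi> + nat (M + 1) - 3) = \<chi> + max 1 (m - 2)"
    using assms unfolding M_def by linarith
  ultimately show ?thesis
    using assms unfolding m_def by (intro exI[of _ G]) auto
qed

end
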